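(* Let $(V,c)$ be a braided vector space over a field $K$ endowed with a bracket $b=(b^{[n]})_{n\in\mathbb N}$. The following assertions are equivalent. (i) The canonical map $i_U:V\to U(V,c,b)$ is injective, i.e. $(V,c,b)$ is a braided Lie algebra. (ii) $b^{[n]}i^{[n]}=\mathrm{Id}_V$ for all $n\in\mathbb N$. (iii) $b^{[0]}i^{[0]}=\mathrm{Id}_V$ and $b^{[n+1]}P(\pi_n^{n+1})=b^{[n]}$ for all $n\in\mathbb N$, where $P(\pi_n^{n+1}):P^{[n]}\to P^{[n+1]}$ is the map induced by the projection $\pi_n^{n+1}:U^{[n]}\to U^{[n+1]}$.
   Context: Fix a field $K$; all vector spaces, tensor products and maps are over $K$ ($K$-linear). An object also denotes its identity map. Braided vector space $(V,c)$: $c:V\otimes V\to V\otimes V$ linear with $(c\otimes V)(V\otimes c)(c\otimes V)=(V\otimes c)(c\otimes V)(V\otimes c)$; a morphism $f:(V,c_V)\to(W,c_W)$ is linear with $c_W(f\otimes f)=(f\otimes f)c_V$. Braided algebra $(A,m,u,c)$: an associative unital algebra and braided vector space with $c(m\otimes A)=(A\otimes m)(c\otimes A)(A\otimes c)$, $c(A\otimes m)=(m\otimes A)(A\otimes c)(c\otimes A)$, $c(u\otimes A)=A\otimes u$, $c(A\otimes u)=u\otimes A$. Braided coalgebra $(C,\Delta,\varepsilon,c)$: a coassociative counital coalgebra and braided vector space with $(\Delta\otimes C)c=(C\otimes c)(c\otimes C)(C\otimes\Delta)$, $(C\otimes\Delta)c=(c\otimes C)(C\otimes c)(\Delta\otimes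 C)$, $(\varepsilon\otimes C)c=C\otimes\varepsilon$, $(C\otimes\varepsilon)c=\varepsilon\otimes C$. Braided bialgebra $(B,m,u,\Delta,\varepsilon,c)$: a braided algebra and braided coalgebra with $\Delta m=(m\otimes m)(B\otimes c\otimes B)(\Delta\otimes\Delta)$, $\Delta(1)=1\otimes 1$, and $\varepsilon$ an algebra map. Morphisms of braided (bi)algebras are (bi)algebra maps that are morphisms of braided vector spaces. $P(B)=\{x\in B\mid \Delta(x)=x\otimes1+1\otimes x\}$. The braiding $c$ of $B$ satisfies $c(P(B)\otimes B)\subseteq B\otimes P(B)$ and $c(B\otimes P(B))\subseteq P(B)\otimes B$. A braided bialgebra map $f:B\to B'$ induces $P(f):P(B)\to P(B')$. Braided tensor algebra $T(V,c)$: the tensor algebra $T(V)$ with the unique braiding $c_T$ extending $c$ and making it a braided algebra, and with $\Delta_T$, $\varepsilon_T$ the algebra maps $\Delta_T:T(V)\to T(V)\otimes_c T(V)$, $\varepsilon_T:T(V)\to K$ such that $\Delta_T(v)=v\otimes1+1\otimes v$, $\varepsilon_T(v)=0$ for $v\in V$, where $T\otimes_cT$ has multiplication $(m_T\otimes m_T)(T\otimes c_T\otimes T)$. A bracket on a braided vector space $(V,c)$ is a family $b=(b^{[n]})_{n\in\mathbb N}$ of linear maps defined together with braided bialgebras $U^{[n]}$ and braided vector space morphisms $i^{[n]}:V\to P^{[n]}:=P(U^{[n]})$ as follows. $U^{[0]}=T(V,c)$ and $i^{[0]}$ is the inclusion. For each $n$, $b^{[n]}:P^{[n]}\to V$ is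 linear and, with $V^{[n]}:=i^{[n]}(V)$ and $c$ the braiding of $U^{[n]}$, one has on $P^{[n]}\otimes V^{[n]}$ and $V^{[n]}\otimes P^{[n]}$ respectively $c(i^{[n]}b^{[n]}\otimes V^{[n]})=(V^{[n]}\otimes i^{[n]}b^{[n]})c$ and $c(V^{[n]}\otimes i^{[n]}b^{[n]})=(i^{[n]}b^{[n]}\otimes V^{[n]})c$ (these make sense as $c$ maps $P^{[n]}\otimes V^{[n]}$ into $V^{[n]}\otimes P^{[n]}$ and conversely). Then $U^{[n+1]}=U^{[n]}/\big((\mathrm{Id}-i^{[n]}b^{[n]})[P^{[n]}]\big)$ (quotient by the two-sided ideal generated) with the unique braided bialgebra structure making the projection $\pi_n^{n+1}:U^{[n]}\to U^{[n+1]}$ a braided bialgebra map, and $i^{[n+1]}=P(\pi_n^{n+1})i^{[n]}$. The universal enveloping algebra is the direct limit $U(V,c,b)=\varinjlim U^{[n]}$ (a braided bialgebra), with canonical map $i_U:V\to U(V,c,b)$. $(V,c,b)$ is a braided Lie algebra if $i_U$ is injective. *)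

theory Defs
  imports "HOL-Algebra.Module" "HOL-Algebra.Ideal" "HOL-Algebra.QuotRing"
begin

section \<open>Linear maps and algebras over a commutative ring\<close>

text \<open>
  A vector space over a field \<open>K\<close> is a record \<open>V\<close> with \<open>module K V\<close>; the multiplicative
  fields of \<open>V\<close> are irrelevant unless \<open>V\<close> is used as an algebra.  The locale \<open>algebra\<close> of the
  library is restricted to commutative algebras, hence \<open>k_algebra\<close>.
\<close>

definition linear_map ::
  "('k, 'r) ring_scheme \<Rightarrow> ('k, 'a, 'm) module_scheme \<Rightarrow> ('k, 'b, 'n) module_scheme \<Rightarrow> ('a \<Rightarrow> 'b) \<Rightarrow> bool"
  where "linear_map K M N f \<longleftrightarrow>
    f \<in> carrier M \<rightarrow> carrier N \<and>
    (\<forall>x\<in>carrier M. \<forall>y\<in>carrier M. f (x \<oplus>\<^bsub>M\<^esub> y) = f x \<oplus>\<^bsub>N\<^esub> f y) \<and>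
    (\<forall>a\<in>carrier K. \<forall>x\<in>carrier M. f (a \<odot>\<^bsub>M\<^esub> x) = a \<odot>\<^bsub>N\<^esub> f x)"

definition k_algebra :: "('k, 'r) ring_scheme \<Rightarrow> ('k, 'a, 'm) module_scheme \<Rightarrow> bool"
  where "k_algebra K A \<longleftrightarrow> module K A \<and> ring A \<and>
    (\<forall>a\<in>carrier K. \<forall>x\<in>carrier A. \<forall>y\<in>carrier A.
      (a \<odot>\<^bsub>A\<^esub> x) \<otimes>\<^bsub>A\<^esub> y = a \<odot>\<^bsub>A\<^esub> (x \<otimes>\<^bsub>A\<^esub> y) \<and>
      x \<otimes>\<^bsub>A\<^esub> (a \<odot>\<^bsub>A\<^esub> y) = a \<odot>\<^bsub>A\<^esub> (x \<otimes>\<^bsub>A\<^esub> y))"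

definition alg_hom ::
  "('k, 'r) ring_scheme \<Rightarrow> ('k, 'a, 'm) module_scheme \<Rightarrow> ('k, 'b, 'n) module_scheme \<Rightarrow> ('a \<Rightarrow> 'b) \<Rightarrow> bool"
  where "alg_hom K A B f \<longleftrightarrow> linear_map K A B f \<and> f \<in> ring_hom A B"

definition base_alg :: "('k, 'r) ring_scheme \<Rightarrow> ('k, 'k) module"
  where "base_alg K = \<lparr>carrier = carrier K, mult = mult K, one = one K, zero = zero K,
    add = add K, smult = mult K\<rparr>"

text \<open>\<open>FactRing\<close> with the induced scalar multiplication, which \<open>FactRing\<close> itself lacks.\<close>

definition quot_alg :: "('k, 'a, 'm) module_scheme \<Rightarrow> 'a set \<Rightarrow> ('k, 'a set) module"
  where "quot_alg A I = \<lparr>carrier = carrier (A Quot I), mult = mult (A Quot I),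
    one = one (A Quot I), zero = zero (A Quot I), add = add (A Quot I),
    smult = (\<lambda>a X. \<Union>x\<in>X. I +>\<^bsub>A\<^esub> (a \<odot>\<^bsub>A\<^esub> x))\<rparr>"

section \<open>The tensor algebra and tensor powers\<close>

text \<open>
  The free algebra on a set \<open>S\<close>: finitely supported functions on words over \<open>S\<close>, with the
  convolution product.
\<close>

type_synonym ('k, 'a) word_fun = "'a list \<Rightarrow> 'k"

definition free_alg :: "('k, 'r) ring_scheme \<Rightarrow> 'a set \<Rightarrow> ('k, ('k, 'a) word_fun) module"
  where "free_alg K S = \<lparr>
    carrier = {f. range f \<subseteq> carrier K \<and> finite {xs. f xs \<noteq> \<zero>\<^bsub>K\<^esub>} \<and> {xs. f xs \<noteq> \<zero>\<^bsub>K\<^esub>} \<subseteq> lists S},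
    mult = (\<lambda>f g xs. \<Oplus>\<^bsub>K\<^esub>i\<in>{..length xs}. f (take i xs) \<otimes>\<^bsub>K\<^esub> g (drop i xs)),
    one = (\<lambda>xs. if xs = [] then \<one>\<^bsub>K\<^esub> else \<zero>\<^bsub>K\<^esub>),
    zero = (\<lambda>xs. \<zero>\<^bsub>K\<^esub>),
    add = (\<lambda>f g xs. f xs \<oplus>\<^bsub>K\<^esub> g xs),
    smult = (\<lambda>a f xs. a \<otimes>\<^bsub>K\<^esub> f xs)\<rparr>"

definition word :: "('k, 'r) ring_scheme \<Rightarrow> 'a list \<Rightarrow> ('k, 'a) word_fun"
  where "word K xs = (\<lambda>ys. if ys = xs then \<one>\<^bsub>K\<^esub> else \<zero>\<^bsub>K\<^esub>)"

text \<open>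
  \<open>T(A)\<close> is the free algebra on the set \<open>A\<close> modulo the relations making \<open>x \<mapsto> word K [x]\<close> linear.
\<close>

type_synonym ('k, 'a) tensor = "('k, 'a) word_fun set"

definition tensor_ideal :: "('k, 'r) ring_scheme \<Rightarrow> ('k, 'a, 'm) module_scheme \<Rightarrow> ('k, 'a) word_fun set"
  where "tensor_ideal K A = (let F = free_alg K (carrier A) in
    Idl\<^bsub>F\<^esub> ({word K [x \<oplus>\<^bsub>A\<^esub> y] \<ominus>\<^bsub>F\<^esub> (word K [x] \<oplus>\<^bsub>F\<^esub> word K [y]) | x y. x \<in> carrier A \<and> y \<in> carrier A}
      \<union> {word K [a \<odot>\<^bsub>A\<^esub> x] \<ominus>\<^bsub>F\<^esub> (a \<odot>\<^bsub>F\<^esub> word K [x]) | a x. a \<in> carrier K \<and> x \<in> carrier A}))"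

definition tensor_alg ::
  "('k, 'r) ring_scheme \<Rightarrow> ('k, 'a, 'm) module_scheme \<Rightarrow> ('k, ('k, 'a) tensor) module"
  where "tensor_alg K A = quot_alg (free_alg K (carrier A)) (tensor_ideal K A)"

definition tensor_class ::
  "('k, 'r) ring_scheme \<Rightarrow> ('k, 'a, 'm) module_scheme \<Rightarrow> ('k, 'a) word_fun \<Rightarrow> ('k, 'a) tensor"
  where "tensor_class K A f = tensor_ideal K A +>\<^bsub>free_alg K (carrier A)\<^esub> f"

text \<open>\<open>pure K A [x\<^sub>1, \<dots>, x\<^sub>d]\<close> is \<open>x\<^sub>1 \<otimes> \<dots> \<otimes> x\<^sub>d\<close>.\<close>

definition pure ::
  "('k, 'r) ring_scheme \<Rightarrow> ('k, 'a, 'm) module_scheme \<Rightarrow> 'a list \<Rightarrow> ('k, 'a) tensor"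
  where "pure K A xs = tensor_class K A (word K xs)"

text \<open>
  For subspaces \<open>X\<^sub>1, \<dots>, X\<^sub>d\<close> of \<open>A\<close>, the subspace \<open>X\<^sub>1 \<otimes> \<dots> \<otimes> X\<^sub>d\<close> of \<open>A\<^sup>\<otimes>\<^sup>d\<close>, inside \<open>T(A)\<close>.
  Identifying all tensor powers of \<open>A\<close> with the homogeneous components of \<open>T(A)\<close> makes the
  associativity and unit constraints (\<open>A\<^sup>\<otimes>\<^sup>0 = K\<close>) identities, as in the usual notation; the
  tensor product of elements of \<open>A\<^sup>\<otimes>\<^sup>p\<close> and \<open>A\<^sup>\<otimes>\<^sup>q\<close> is their product in \<open>T(A)\<close>.
\<close>

definition word_combs ::
  "('k, 'r) ring_scheme \<Rightarrow> ('k, 'a, 'm) module_scheme \<Rightarrow> 'a set list \<Rightarrow> ('k, 'a) word_fun set"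
  where "word_combs K A Xs = {f \<in> carrier (free_alg K (carrier A)).
    \<forall>xs. f xs \<noteq> \<zero>\<^bsub>K\<^esub> \<longrightarrow> list_all2 (\<in>) xs Xs}"

definition subspace_tensor ::
  "('k, 'r) ring_scheme \<Rightarrow> ('k, 'a, 'm) module_scheme \<Rightarrow> 'a set list \<Rightarrow> ('k, 'a) tensor set"
  where "subspace_tensor K A Xs = tensor_class K A ` word_combs K A Xs"

definition tensor_power ::
  "('k, 'r) ring_scheme \<Rightarrow> ('k, 'a, 'm) module_scheme \<Rightarrow> nat \<Rightarrow> ('k, ('k, 'a) tensor) module"
  where "tensor_power K A d =
    (tensor_alg K A)\<lparr>carrier := subspace_tensor K A (replicate d (carrier A))\<rparr>"

text \<open>
  The linear map \<open>X\<^sub>1 \<otimes> \<dots> \<otimes> X\<^sub>d \<rightarrow> M\<close> sending \<open>x\<^sub>1 \<otimes> \<dots> \<otimes> x\<^sub>d\<close> to \<open>g [x\<^sub>1, \<dots>, x\<^sub>d]\<close>, for \<open>g\<close> multilinear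
  on \<open>X\<^sub>1 \<times> \<dots> \<times> X\<^sub>d\<close>.  A representative supported on words from \<open>X\<^sub>1 \<times> \<dots> \<times> X\<^sub>d\<close> has to be
  chosen, as \<open>g\<close> is meaningful only on those; the choice does not matter (\<open>K\<close> being a field).
\<close>

definition tensor_lift ::
  "('k, 'r) ring_scheme \<Rightarrow> ('k, 'a, 'm) module_scheme \<Rightarrow> ('k, 'b, 'n) module_scheme \<Rightarrow>
    'a set list \<Rightarrow> ('a list \<Rightarrow> 'b) \<Rightarrow> ('k, 'a) tensor \<Rightarrow> 'b"
  where "tensor_lift K A M Xs g t =
    (let f = (SOME f. f \<in> word_combs K A Xs \<and> tensor_class K A f = t)
     in \<Oplus>\<^bsub>M\<^esub>xs\<in>{xs. f xs \<noteq> \<zero>\<^bsub>K\<^esub>}. f xs \<odot>\<^bsub>M\<^esub> g xs)"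

text \<open>\<open>f \<otimes> g\<close> for linear maps \<open>f\<close>, \<open>g\<close> defined on \<open>A\<^sup>\<otimes>\<^sup>p\<close>, \<open>A\<^sup>\<otimes>\<^sup>q\<close>, with values in tensor powers of \<open>A\<close>.\<close>

definition tensor_maps ::
  "('k, 'r) ring_scheme \<Rightarrow> ('k, 'a, 'm) module_scheme \<Rightarrow> nat \<Rightarrow> nat \<Rightarrow>
    (('k, 'a) tensor \<Rightarrow> ('k, 'a) tensor) \<Rightarrow> (('k, 'a) tensor \<Rightarrow> ('k, 'a) tensor) \<Rightarrow>
    ('k, 'a) tensor \<Rightarrow> ('k, 'a) tensor"
  where "tensor_maps K A p q f g =
    tensor_lift K A (tensor_alg K A) (replicate (p + q) (carrier A))
      (\<lambda>xs. f (pure K A (take p xs)) \<otimes>\<^bsub>tensor_alg K A\<^esub> g (pure K A (drop p xs)))"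

text \<open>\<open>f\<^sup>\<otimes>\<^sup>d : A\<^sup>\<otimes>\<^sup>d \<rightarrow> B\<^sup>\<otimes>\<^sup>d\<close> for linear \<open>f : A \<rightarrow> B\<close>.\<close>

definition map_power ::
  "('k, 'r) ring_scheme \<Rightarrow> ('k, 'a, 'm) module_scheme \<Rightarrow> ('k, 'b, 'n) module_scheme \<Rightarrow> nat \<Rightarrow>
    ('a \<Rightarrow> 'b) \<Rightarrow> ('k, 'a) tensor \<Rightarrow> ('k, 'b) tensor"
  where "map_power K A B d f =
    tensor_lift K A (tensor_alg K B) (replicate d (carrier A)) (\<lambda>xs. pure K B (map f xs))"

text \<open>
  The structure maps \<open>A\<^sup>\<otimes>\<^sup>2 \<rightarrow> A\<^sup>\<otimes>\<^sup>1\<close>, \<open>A\<^sup>\<otimes>\<^sup>0 \<rightarrow> A\<^sup>\<otimes>\<^sup>1\<close>, \<open>A\<^sup>\<otimes>\<^sup>1 \<rightarrow> A\<^sup>\<otimes>\<^sup>2\<close> and \<open>A\<^sup>\<otimes>\<^sup>1 \<rightarrow> A\<^sup>\<otimes>\<^sup>0\<close> given by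
  multiplication, unit, comultiplication \<open>\<Delta>\<close> and counit \<open>\<epsilon>\<close>.
\<close>

definition mult_t ::
  "('k, 'r) ring_scheme \<Rightarrow> ('k, 'a, 'm) module_scheme \<Rightarrow> ('k, 'a) tensor \<Rightarrow> ('k, 'a) tensor"
  where "mult_t K A = tensor_lift K A (tensor_alg K A) [carrier A, carrier A]
    (\<lambda>xs. pure K A [xs ! 0 \<otimes>\<^bsub>A\<^esub> xs ! 1])"

definition unit_t ::
  "('k, 'r) ring_scheme \<Rightarrow> ('k, 'a, 'm) module_scheme \<Rightarrow> ('k, 'a) tensor \<Rightarrow> ('k, 'a) tensor"
  where "unit_t K A = tensor_lift K A (tensor_alg K A) [] (\<lambda>xs. pure K A [\<one>\<^bsub>A\<^esub>])"

definition comult_t ::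
  "('k, 'r) ring_scheme \<Rightarrow> ('k, 'a, 'm) module_scheme \<Rightarrow> ('a \<Rightarrow> ('k, 'a) tensor) \<Rightarrow>
    ('k, 'a) tensor \<Rightarrow> ('k, 'a) tensor"
  where "comult_t K A \<Delta> = tensor_lift K A (tensor_alg K A) [carrier A] (\<lambda>xs. \<Delta> (xs ! 0))"

definition counit_t ::
  "('k, 'r) ring_scheme \<Rightarrow> ('k, 'a, 'm) module_scheme \<Rightarrow> ('a \<Rightarrow> 'k) \<Rightarrow>
    ('k, 'a) tensor \<Rightarrow> ('k, 'a) tensor"
  where "counit_t K A \<epsilon> = tensor_lift K A (tensor_alg K A) [carrier A]
    (\<lambda>xs. \<epsilon> (xs ! 0) \<odot>\<^bsub>tensor_alg K A\<^esub> \<one>\<^bsub>tensor_alg K A\<^esub>)"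

section \<open>Braided structures\<close>

definition braided_vector_space ::
  "('k, 'r) ring_scheme \<Rightarrow> ('k, 'a, 'm) module_scheme \<Rightarrow>
    (('k, 'a) tensor \<Rightarrow> ('k, 'a) tensor) \<Rightarrow> bool"
  where "braided_vector_space K V c \<longleftrightarrow> module K V \<and>
    linear_map K (tensor_power K V 2) (tensor_power K V 2) c \<and>
    (let cV = tensor_maps K V 2 1 c id; Vc = tensor_maps K V 1 2 id c in
      \<forall>t\<in>carrier (tensor_power K V 3). cV (Vc (cV t)) = Vc (cV (Vc t)))"

definition braided_map ::
  "('k, 'r) ring_scheme \<Rightarrow> ('k, 'a, 'm) module_scheme \<Rightarrow> (('k, 'a) tensor \<Rightarrow> ('k, 'a) tensor) \<Rightarrow>
    ('k, 'b, 'n) module_scheme \<Rightarrow> (('k, 'b) tensor \<Rightarrow> ('k, 'b) tensor) \<Rightarrow> ('a \<Rightarrow> 'b) \<Rightarrow> bool"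
  where "braided_map K V cV W cW f \<longleftrightarrow> linear_map K V W f \<and>
    (\<forall>t\<in>carrier (tensor_power K V 2). cW (map_power K V W 2 f t) = map_power K V W 2 f (cV t))"

definition braided_algebra ::
  "('k, 'r) ring_scheme \<Rightarrow> ('k, 'a, 'm) module_scheme \<Rightarrow>
    (('k, 'a) tensor \<Rightarrow> ('k, 'a) tensor) \<Rightarrow> bool"
  where "braided_algebra K A c \<longleftrightarrow> k_algebra K A \<and> braided_vector_space K A c \<and>
    (let m = mult_t K A; u = unit_t K A;
         cA = tensor_maps K A 2 1 c id; Ac = tensor_maps K A 1 2 id c in
      (\<forall>t\<in>carrier (tensor_power K A 3).
        c (tensor_maps K A 2 1 m id t) = tensor_maps K A 1 2 id m (cA (Ac t)) \<and>
        c (tensor_maps K A 1 2 id m t) = tensor_maps K A 2 1 m id (Ac (cA t))) \<and>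
      (\<forall>t\<in>carrier (tensor_power K A 1).
        c (tensor_maps K A 0 1 u id t) = tensor_maps K A 1 0 id u t \<and>
        c (tensor_maps K A 1 0 id u t) = tensor_maps K A 0 1 u id t))"

definition braided_coalgebra ::
  "('k, 'r) ring_scheme \<Rightarrow> ('k, 'a, 'm) module_scheme \<Rightarrow> ('a \<Rightarrow> ('k, 'a) tensor) \<Rightarrow> ('a \<Rightarrow> 'k) \<Rightarrow>
    (('k, 'a) tensor \<Rightarrow> ('k, 'a) tensor) \<Rightarrow> bool"
  where "braided_coalgebra K C \<Delta> \<epsilon> c \<longleftrightarrow> braided_vector_space K C c \<and>
    linear_map K C (tensor_power K C 2) \<Delta> \<and> linear_map K C (base_alg K) \<epsilon> \<and>
    (let D = comult_t K C \<Delta>; e = counit_t K C \<epsilon>;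
         cC = tensor_maps K C 2 1 c id; Cc = tensor_maps K C 1 2 id c in
      (\<forall>t\<in>carrier (tensor_power K C 1).
        tensor_maps K C 1 1 D id (D t) = tensor_maps K C 1 1 id D (D t) \<and>
        tensor_maps K C 1 1 e id (D t) = t \<and>
        tensor_maps K C 1 1 id e (D t) = t) \<and>
      (\<forall>t\<in>carrier (tensor_power K C 2).
        tensor_maps K C 1 1 D id (c t) = Cc (cC (tensor_maps K C 1 1 id D t)) \<and>
        tensor_maps K C 1 1 id D (c t) = cC (Cc (tensor_maps K C 1 1 D id t)) \<and>
        tensor_maps K C 1 1 e id (c t) = tensor_maps K C 1 1 id e t \<and>
        tensor_maps K C 1 1 id e (c t) = tensor_maps K C 1 1 e id t))"

record ('k, 'a) braided_bialg = "('k, 'a) module" +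
  comult :: "'a \<Rightarrow> ('k, 'a) tensor"
  counit :: "'a \<Rightarrow> 'k"
  braid :: "('k, 'a) tensor \<Rightarrow> ('k, 'a) tensor"

text \<open>\<open>(m \<otimes> m)(A \<otimes> c \<otimes> A) : A\<^sup>\<otimes>\<^sup>4 \<rightarrow> A\<^sup>\<otimes>\<^sup>2\<close>\<close>

definition twisted_mult_t ::
  "('k, 'r) ring_scheme \<Rightarrow> ('k, 'a, 'm) module_scheme \<Rightarrow> (('k, 'a) tensor \<Rightarrow> ('k, 'a) tensor) \<Rightarrow>
    ('k, 'a) tensor \<Rightarrow> ('k, 'a) tensor"
  where "twisted_mult_t K A c t = tensor_maps K A 2 2 (mult_t K A) (mult_t K A)
    (tensor_maps K A 1 3 id (tensor_maps K A 2 1 c id) t)"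

definition braided_bialgebra :: "('k, 'r) ring_scheme \<Rightarrow> ('k, 'a) braided_bialg \<Rightarrow> bool"
  where "braided_bialgebra K B \<longleftrightarrow>
    braided_algebra K B (braid B) \<and>
    braided_coalgebra K B (comult B) (counit B) (braid B) \<and>
    (let D = comult_t K B (comult B) in
      \<forall>t\<in>carrier (tensor_power K B 2).
        D (mult_t K B t) = twisted_mult_t K B (braid B) (tensor_maps K B 1 1 D D t)) \<and>
    comult B \<one>\<^bsub>B\<^esub> = pure K B [\<one>\<^bsub>B\<^esub>, \<one>\<^bsub>B\<^esub>] \<and>
    alg_hom K B (base_alg K) (counit B)"

definition braided_bialgebra_map ::
  "('k, 'r) ring_scheme \<Rightarrow> ('k, 'a) braided_bialg \<Rightarrow> ('k, 'b) braided_bialg \<Rightarrow> ('a \<Rightarrow> 'b) \<Rightarrow> bool"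
  where "braided_bialgebra_map K B B' f \<longleftrightarrow>
    alg_hom K B B' f \<and>
    (\<forall>x\<in>carrier B. comult B' (f x) = map_power K B B' 2 f (comult B x) \<and>
      counit B' (f x) = counit B x) \<and>
    braided_map K B (braid B) B' (braid B') f"

definition primitives :: "('k, 'r) ring_scheme \<Rightarrow> ('k, 'a) braided_bialg \<Rightarrow> 'a set"
  where "primitives K B = {x \<in> carrier B.
    comult B x = pure K B [x, \<one>\<^bsub>B\<^esub>] \<oplus>\<^bsub>tensor_alg K B\<^esub> pure K B [\<one>\<^bsub>B\<^esub>, x]}"

text \<open>The map \<open>P(f) : P(B) \<rightarrow> P(B')\<close> induced by \<open>f : B \<rightarrow> B'\<close>.\<close>

definition primitives_map ::
  "('k, 'r) ring_scheme \<Rightarrow> ('k, 'a) braided_bialg \<Rightarrow> ('a \<Rightarrow> 'b) \<Rightarrow> 'a \<Rightarrow> 'b"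
  where "primitives_map K B f = restrict f (primitives K B)"

section \<open>Braided tensor algebra, quotients and sequential colimits\<close>

definition tensor_incl :: "('k, 'r) ring_scheme \<Rightarrow> ('k, 'a, 'm) module_scheme \<Rightarrow> 'a \<Rightarrow> ('k, 'a) tensor"
  where "tensor_incl K V v = pure K V [v]"

text \<open>
  \<open>T = T(V, c)\<close>.  That \<open>T\<close> is a braided algebra, and that \<open>\<Delta>\<^sub>T : T \<rightarrow> T \<otimes>\<^sub>c T\<close> and \<open>\<epsilon>\<^sub>T : T \<rightarrow> K\<close> are
  algebra maps, is contained in \<open>braided_bialgebra K T\<close>; the remaining conditions then determine
  \<open>c\<^sub>T\<close>, \<open>\<Delta>\<^sub>T\<close> and \<open>\<epsilon>\<^sub>T\<close>.
\<close>

definition is_braided_tensor_algebra ::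
  "('k, 'r) ring_scheme \<Rightarrow> ('k, 'a, 'm) module_scheme \<Rightarrow> (('k, 'a) tensor \<Rightarrow> ('k, 'a) tensor) \<Rightarrow>
    ('k, ('k, 'a) tensor) braided_bialg \<Rightarrow> bool"
  where "is_braided_tensor_algebra K V c T \<longleftrightarrow> (let j = tensor_incl K V in
    module.truncate T = tensor_alg K V \<and>
    braided_bialgebra K T \<and>
    braided_map K V c T (braid T) j \<and>
    (\<forall>v\<in>carrier V.
      comult T (j v) = pure K T [j v, \<one>\<^bsub>T\<^esub>] \<oplus>\<^bsub>tensor_alg K T\<^esub> pure K T [\<one>\<^bsub>T\<^esub>, j v] \<and>
      counit T (j v) = \<zero>\<^bsub>K\<^esub>))"

text \<open>
  \<open>B'\<close> is the quotient of \<open>B\<close> by the two-sided ideal \<open>I\<close>, with projection \<open>p\<close> and the (unique)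
  braided bialgebra structure making \<open>p\<close> a braided bialgebra map.  Quotients are described up to
  isomorphism, and not as sets of cosets, so that a sequence of iterated quotients can be formed
  on one type.
\<close>

definition is_bialg_quotient ::
  "('k, 'r) ring_scheme \<Rightarrow> ('k, 'a) braided_bialg \<Rightarrow> 'a set \<Rightarrow>
    ('k, 'b) braided_bialg \<Rightarrow> ('a \<Rightarrow> 'b) \<Rightarrow> bool"
  where "is_bialg_quotient K B I B' p \<longleftrightarrow>
    braided_bialgebra K B' \<and> braided_bialgebra_map K B B' p \<and>
    p ` carrier B = carrier B' \<and> {x \<in> carrier B. p x = \<zero>\<^bsub>B'\<^esub>} = I"

definition with_costructure ::
  "('k, 'a) module \<Rightarrow> ('a \<Rightarrow> ('k, 'a) tensor) \<Rightarrow> ('a \<Rightarrow> 'k) \<Rightarrow>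
    (('k, 'a) tensor \<Rightarrow> ('k, 'a) tensor) \<Rightarrow> ('k, 'a) braided_bialg"
  where "with_costructure A \<Delta> \<epsilon> c = \<lparr>carrier = carrier A, mult = mult A, one = one A,
    zero = zero A, add = add A, smult = smult A, comult = \<Delta>, counit = \<epsilon>, braid = c\<rparr>"

text \<open>
  The direct limit of \<open>B 0 \<rightarrow> B 1 \<rightarrow> \<dots>\<close> along \<open>f n : B n \<rightarrow> B (Suc n)\<close>: elements are the classes of
  pairs \<open>(n, x)\<close> with \<open>x \<in> B n\<close>, two pairs being identified if they become equal at a later stage.
\<close>

primrec transition :: "(nat \<Rightarrow> 'a \<Rightarrow> 'a) \<Rightarrow> nat \<Rightarrow> nat \<Rightarrow> 'a \<Rightarrow> 'a"
  where "transition f n 0 = id"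
  | "transition f n (Suc k) = f (n + k) \<circ> transition f n k"

definition limit_rel ::
  "(nat \<Rightarrow> ('k, 'a) braided_bialg) \<Rightarrow> (nat \<Rightarrow> 'a \<Rightarrow> 'a) \<Rightarrow> ((nat \<times> 'a) \<times> (nat \<times> 'a)) set"
  where "limit_rel B f = {((m, x), (n, y)). x \<in> carrier (B m) \<and> y \<in> carrier (B n) \<and>
    (\<exists>k l. m + k = n + l \<and> transition f m k x = transition f n l y)}"

definition limit_incl ::
  "(nat \<Rightarrow> ('k, 'a) braided_bialg) \<Rightarrow> (nat \<Rightarrow> 'a \<Rightarrow> 'a) \<Rightarrow> nat \<Rightarrow> 'a \<Rightarrow> (nat \<times> 'a) set"
  where "limit_incl B f n x = limit_rel B f `` {(n, x)}"

definition limit_alg ::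
  "(nat \<Rightarrow> ('k, 'a) braided_bialg) \<Rightarrow> (nat \<Rightarrow> 'a \<Rightarrow> 'a) \<Rightarrow> ('k, (nat \<times> 'a) set) module"
  where "limit_alg B f = (let j = limit_incl B f in \<lparr>
    carrier = (SIGMA n : UNIV. carrier (B n)) // limit_rel B f,
    mult = (\<lambda>X Y. THE Z. \<exists>n. \<exists>x\<in>carrier (B n). \<exists>y\<in>carrier (B n).
      X = j n x \<and> Y = j n y \<and> Z = j n (x \<otimes>\<^bsub>B n\<^esub> y)),
    one = j 0 \<one>\<^bsub>B 0\<^esub>,
    zero = j 0 \<zero>\<^bsub>B 0\<^esub>,
    add = (\<lambda>X Y. THE Z. \<exists>n. \<exists>x\<in>carrier (B n). \<exists>y\<in>carrier (B n).
      X = j n x \<and> Y = j n y \<and> Z = j n (x \<oplus>\<^bsub>B n\<^esub> y)),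
    smult = (\<lambda>a X. THE Z. \<exists>n. \<exists>x\<in>carrier (B n). X = j n x \<and> Z = j n (a \<odot>\<^bsub>B n\<^esub> x))\<rparr>)"

definition limit_bialg ::
  "('k, 'r) ring_scheme \<Rightarrow> (nat \<Rightarrow> ('k, 'a) braided_bialg) \<Rightarrow> (nat \<Rightarrow> 'a \<Rightarrow> 'a) \<Rightarrow>
    ('k, (nat \<times> 'a) set) braided_bialg"
  where "limit_bialg K B f = (let L = limit_alg B f; j = limit_incl B f in
    with_costructure L
      (\<lambda>X. THE t. \<exists>n. \<exists>x\<in>carrier (B n). X = j n x \<and> t = map_power K (B n) L 2 (j n) (comult (B n) x))
      (\<lambda>X. THE a. \<exists>n. \<exists>x\<in>carrier (B n). X = j n x \<and> a = counit (B n) x)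
      (\<lambda>t. THE t'. \<exists>n. \<exists>s\<in>carrier (tensor_power K (B n) 2).
        t = map_power K (B n) L 2 (j n) s \<and> t' = map_power K (B n) L 2 (j n) (braid (B n) s)))"

section \<open>Brackets and the universal enveloping algebra\<close>

text \<open>
  The ideal generated by \<open>(Id - i b)[P(B)]\<close>.
\<close>

definition bracket_ideal ::
  "('k, 'r) ring_scheme \<Rightarrow> ('k, 'a) braided_bialg \<Rightarrow> ('v \<Rightarrow> 'a) \<Rightarrow> ('a \<Rightarrow> 'v) \<Rightarrow> 'a set"
  where "bracket_ideal K B i b = Idl\<^bsub>B\<^esub> ((\<lambda>x. x \<ominus>\<^bsub>B\<^esub> i (b x)) ` primitives K B)"

text \<open>
  The bracket \<open>b = (b\<^sup>[\<^sup>n\<^sup>])\<close> on \<open>(V, c)\<close>, together with the data defined along with it: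
  \<open>U n = U\<^sup>[\<^sup>n\<^sup>]\<close>, \<open>i n = i\<^sup>[\<^sup>n\<^sup>]\<close> and the projections \<open>p n : U\<^sup>[\<^sup>n\<^sup>] \<rightarrow> U\<^sup>[\<^sup>n\<^sup>+\<^sup>1\<^sup>]\<close>.  All \<open>U n\<close> live on the type
  of \<open>T(V)\<close>, which is no restriction: a quotient of \<open>T(V)\<close> is isomorphic to one whose carrier
  is a system of representatives.  The value of \<open>b n\<close> is irrelevant outside \<open>P (U n)\<close>.  The last two
  conjuncts are the compatibilities on \<open>P\<^sup>[\<^sup>n\<^sup>] \<otimes> V\<^sup>[\<^sup>n\<^sup>]\<close> and \<open>V\<^sup>[\<^sup>n\<^sup>] \<otimes> P\<^sup>[\<^sup>n\<^sup>]\<close>, where \<open>V\<^sup>[\<^sup>n\<^sup>]\<close> is \<open>W\<close>.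
\<close>

definition bracket ::
  "('k, 'r) ring_scheme \<Rightarrow> ('k, 'v, 'm) module_scheme \<Rightarrow> (('k, 'v) tensor \<Rightarrow> ('k, 'v) tensor) \<Rightarrow>
    (nat \<Rightarrow> ('k, ('k, 'v) tensor) braided_bialg) \<Rightarrow> (nat \<Rightarrow> 'v \<Rightarrow> ('k, 'v) tensor) \<Rightarrow>
    (nat \<Rightarrow> ('k, 'v) tensor \<Rightarrow> ('k, 'v) tensor) \<Rightarrow> (nat \<Rightarrow> ('k, 'v) tensor \<Rightarrow> 'v) \<Rightarrow> bool"
  where "bracket K V c U i p b \<longleftrightarrow>
    is_braided_tensor_algebra K V c (U 0) \<and>
    (\<forall>v\<in>carrier V. i 0 v = tensor_incl K V v) \<and>
    (\<forall>n. is_bialg_quotient K (U n) (bracket_ideal K (U n) (i n) (b n)) (U (Suc n)) (p n)) \<and>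
    (\<forall>n. \<forall>v\<in>carrier V. i (Suc n) v = primitives_map K (U n) (p n) (i n v)) \<and>
    (\<forall>n. i n ` carrier V \<subseteq> primitives K (U n) \<and> braided_map K V c (U n) (braid (U n)) (i n)) \<and>
    (\<forall>n. let B = U n; T = tensor_alg K B; P = primitives K B; W = i n ` carrier V;
          ib = (\<lambda>x. i n (b n x));
          ibW = tensor_lift K B T [P, W] (\<lambda>xs. pure K B [ib (xs ! 0), xs ! 1]);
          Wib = tensor_lift K B T [W, P] (\<lambda>xs. pure K B [xs ! 0, ib (xs ! 1)])
      in linear_map K (B\<lparr>carrier := P\<rparr>) V (b n) \<and>
        (\<forall>t\<in>subspace_tensor K B [P, W]. braid B (ibW t) = Wib (braid B t)) \<and>
        (\<forall>t\<in>subspace_tensor K B [W, P]. braid B (Wib t) = ibW (braid B t)))"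

definition enveloping_algebra ::
  "('k, 'r) ring_scheme \<Rightarrow> (nat \<Rightarrow> ('k, 'a) braided_bialg) \<Rightarrow> (nat \<Rightarrow> 'a \<Rightarrow> 'a) \<Rightarrow>
    ('k, (nat \<times> 'a) set) braided_bialg"
  where "enveloping_algebra K U p = limit_bialg K U p"

text \<open>\<open>i\<^sub>U\<close>: the composite of \<open>i\<^sup>[\<^sup>0\<^sup>]\<close> and the canonical map \<open>U\<^sup>[\<^sup>0\<^sup>] \<rightarrow> U(V, c, b)\<close>.\<close>

definition enveloping_incl ::
  "(nat \<Rightarrow> ('k, 'a) braided_bialg) \<Rightarrow> (nat \<Rightarrow> 'v \<Rightarrow> 'a) \<Rightarrow> (nat \<Rightarrow> 'a \<Rightarrow> 'a) \<Rightarrow> 'v \<Rightarrow> (nat \<times> 'a) set"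
  where "enveloping_incl U i p v = limit_incl U p 0 (i 0 v)"

definition braided_lie_algebra ::
  "('k, 'r) ring_scheme \<Rightarrow> ('k, 'v, 'm) module_scheme \<Rightarrow> (('k, 'v) tensor \<Rightarrow> ('k, 'v) tensor) \<Rightarrow>
    (nat \<Rightarrow> ('k, ('k, 'v) tensor) braided_bialg) \<Rightarrow> (nat \<Rightarrow> 'v \<Rightarrow> ('k, 'v) tensor) \<Rightarrow>
    (nat \<Rightarrow> ('k, 'v) tensor \<Rightarrow> ('k, 'v) tensor) \<Rightarrow> (nat \<Rightarrow> ('k, 'v) tensor \<Rightarrow> 'v) \<Rightarrow> bool"
  where "braided_lie_algebra K V c U i p b \<longleftrightarrow>
    braided_vector_space K V c \<and> bracket K V c U i p b \<and>
    inj_on (enveloping_incl U i p) (carrier V)"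

end

theory Submission
  imports Defs
begin

text \<open>
  In \<open>U\<^sup>[\<^sup>n\<^sup>+\<^sup>1\<^sup>]\<close> every primitive \<open>x\<close> of \<open>U\<^sup>[\<^sup>n\<^sup>]\<close> is identified with \<open>i\<^sup>[\<^sup>n\<^sup>] (b\<^sup>[\<^sup>n\<^sup>] x)\<close>, so
  \<open>P(\<pi>) = i\<^sup>[\<^sup>n\<^sup>+\<^sup>1\<^sup>] b\<^sup>[\<^sup>n\<^sup>]\<close>; composing with \<open>i\<^sup>[\<^sup>n\<^sup>]\<close> gives \<open>i\<^sup>[\<^sup>n\<^sup>+\<^sup>1\<^sup>] = i\<^sup>[\<^sup>n\<^sup>+\<^sup>1\<^sup>] b\<^sup>[\<^sup>n\<^sup>] i\<^sup>[\<^sup>n\<^sup>]\<close>.  As \<open>i\<^sub>U\<close> is the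
  limit of the \<open>i\<^sup>[\<^sup>n\<^sup>]\<close>, it is injective iff all \<open>i\<^sup>[\<^sup>n\<^sup>]\<close> are, and the equivalences follow.
\<close>

lemma transition_add:
  "transition f n (k + l) x = transition f (n + k) l (transition f n k x)"
  by (induction l) (simp_all add: add.assoc)

lemma limit_relI:
  assumes "x \<in> carrier (B m)" "y \<in> carrier (B n)" "m + k = n + l"
    and "transition f m k x = transition f n l y"
  shows "((m, x), (n, y)) \<in> limit_rel B f"
  using assms unfolding limit_rel_def by blast

lemma limit_relE:
  assumes "((m, x), (n, y)) \<in> limit_rel B f"
  obtains k l where "x \<in> carrier (B m)" "y \<in> carrier (B n)" "m + k = n + l"
    "transition f m k x = transition f n l y"
  using assms unfolding limit_rel_def by blast

lemma sym_limit_rel: "sym (limit_rel B f)"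
proof (rule symI, clarify)
  fix m x n y
  assume "((m, x), (n, y)) \<in> limit_rel B f"
  then show "((n, y), (m, x)) \<in> limit_rel B f"
    by (elim limit_relE) (rule limit_relI, assumption+, (erule sym)+)
qed

text \<open>Both identifications are pushed to a common later stage: the first by \<open>k'\<close>
  further steps, the second by \<open>l\<close>. The middle terms, images of \<open>y\<close> after
  \<open>l + k'\<close> and \<open>k' + l\<close> steps, then agree.\<close>

lemma trans_limit_rel: "trans (limit_rel B f)"
proof (rule transI, clarify)
  fix m x n y q z
  assume "((m, x), (n, y)) \<in> limit_rel B f" and "((n, y), (q, z)) \<in> limit_rel B f"
  then obtain k l k' l' where x: "x \<in> carrier (B m)" and z: "z \<in> carrier (B q)"
    and s: "m + k = n + l" "n + k' = q + l'"
    and e: "transition f m k x = transition f n l y" "transition f n k' y = transition f q l' z"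
    by (elim limit_relE) blast
  have "transition f m (k + k') x = transition f n (l + k') y"
    by (simp add: transition_add e s)
  also have "\<dots> = transition f (n + k') l (transition f n k' y)"
    by (simp only: add.commute[of l k'] transition_add)
  also have "\<dots> = transition f q (l' + l) z"
    by (simp only: e s transition_add)
  finally show "((m, x), (q, z)) \<in> limit_rel B f"
    using limit_relI[of x B m z q "k + k'" "l' + l" f] x z s by simp
qed

lemma limit_incl_eq_iff:
  assumes "x \<in> carrier (B m)" "y \<in> carrier (B n)"
  shows "limit_incl B f m x = limit_incl B f n y \<longleftrightarrow>
    (\<exists>k l. m + k = n + l \<and> transition f m k x = transition f n l y)"
proof
  \<comment> \<open>Reflexivity puts \<open>(n, y)\<close> into its own class, hence into the equal
    class of \<open>(m, x)\<close>.\<close>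
  have "((n, y), (n, y)) \<in> limit_rel B f"
    using assms(2) limit_relI by fast
  then show "limit_incl B f m x = limit_incl B f n y \<Longrightarrow>
      \<exists>k l. m + k = n + l \<and> transition f m k x = transition f n l y"
    unfolding limit_incl_def by (blast elim: limit_relE)
next
  assume "\<exists>k l. m + k = n + l \<and> transition f m k x = transition f n l y"
  then have "((m, x), (n, y)) \<in> limit_rel B f"
    using assms by (elim exE conjE) (rule limit_relI)
  then show "limit_incl B f m x = limit_incl B f n y"
    unfolding limit_incl_def
    using symD[OF sym_limit_rel] transD[OF trans_limit_rel] by blast
qed

text \<open>The quotient is given only up to isomorphism, through a ring homomorphism
  \<open>p\<close> with kernel \<open>I\<close>, so \<open>p\<close> kills the difference.\<close>

lemma bialg_quotient_eq:
  assumes q: "is_bialg_quotient K B I B' p" and B: "ring B"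
    and x: "x \<in> carrier B" and y: "y \<in> carrier B" and I: "x \<ominus>\<^bsub>B\<^esub> y \<in> I"
  shows "p x = p y"
proof -
  have "ring B'" "p \<in> ring_hom B B'"
    using q by (auto simp: is_bialg_quotient_def braided_bialgebra_def braided_algebra_def
        k_algebra_def braided_bialgebra_map_def alg_hom_def)
  then interpret ring_hom_ring B B' p
    using B by (simp add: ring_hom_ring_def ring_hom_ring_axioms_def)
  have "p (x \<ominus>\<^bsub>B\<^esub> y) = \<zero>\<^bsub>B'\<^esub>"
    using q I by (auto simp: is_bialg_quotient_def)
  then have "p x \<oplus>\<^bsub>B'\<^esub> \<ominus>\<^bsub>B'\<^esub> p y = \<zero>\<^bsub>B'\<^esub>"
    using x y by (simp add: a_minus_def)
  then have "\<ominus>\<^bsub>B'\<^esub> (\<ominus>\<^bsub>B'\<^esub> p y) = p x"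
    using x y by (intro S.minus_equality) simp_all
  then show ?thesis
    using y by simp
qed

context
  fixes K V c U i p b
  assumes br: "bracket K V c U i p b"
begin

lemma bracket_tensor_algebra: "is_braided_tensor_algebra K V c (U 0)"
  using br unfolding bracket_def by (elim conjE)

lemma bracket_quotient:
  "is_bialg_quotient K (U n) (bracket_ideal K (U n) (i n) (b n)) (U (Suc n)) (p n)"
  using br unfolding bracket_def by (elim conjE) (erule spec)

lemma bracket_ring: "ring (U n)"
proof -
  have "braided_bialgebra K (U n)"
    using bracket_tensor_algebra bracket_quotient
    by (cases n) (simp_all add: is_braided_tensor_algebra_def Let_def is_bialg_quotient_def)
  then show ?thesis
    by (simp add: braided_bialgebra_def braided_algebra_def k_algebra_def)
qed

lemma bracket_incl_primitive: "v \<in> carrier V \<Longrightarrow> i n v \<in> primitives K (U n)"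
  using br unfolding bracket_def by (elim conjE) blast

lemma bracket_incl_closed: "v \<in> carrier V \<Longrightarrow> i n v \<in> carrier (U n)"
  using bracket_incl_primitive by (auto simp: primitives_def)

lemma bracket_closed: "x \<in> primitives K (U n) \<Longrightarrow> b n x \<in> carrier V"
  using br unfolding bracket_def Let_def linear_map_def
  by (elim conjE) (drule spec[of _ n], auto)

lemma bracket_incl_Suc: "v \<in> carrier V \<Longrightarrow> i (Suc n) v = p n (i n v)"
  using br bracket_incl_primitive[of v n] unfolding bracket_def
  by (elim conjE) (simp add: primitives_map_def)

text \<open>Links \<open>enveloping_incl\<close>, defined from stage 0, to the maps
  \<open>i n\<close>.\<close>

lemma bracket_incl_transition: "v \<in> carrier V \<Longrightarrow> transition p 0 n (i 0 v) = i n v"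
  by (induction n) (simp_all add: bracket_incl_Suc)

text \<open>The difference of \<open>x\<close> and \<open>i n (b n x)\<close> is a generator of the
  ideal killed by \<open>p n\<close>.\<close>

lemma bracket_proj:
  assumes x: "x \<in> primitives K (U n)"
  shows "p n x = i (Suc n) (b n x)"
proof -
  have "x \<ominus>\<^bsub>U n\<^esub> i n (b n x) \<in> bracket_ideal K (U n) (i n) (b n)"
    using x unfolding bracket_ideal_def genideal_def by blast
  moreover have "x \<in> carrier (U n)"
    using x by (simp add: primitives_def)
  ultimately have "p n x = p n (i n (b n x))"
    using bialg_quotient_eq[OF bracket_quotient bracket_ring] bracket_incl_closed bracket_closed[OF x] by blast
  then show ?thesis
    by (simp add: bracket_incl_Suc bracket_closed[OF x])
qed

text \<open>Both representatives start at stage 0, so reaching a common stage takes the same number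
  \<open>n\<close> of steps from each.\<close>

lemma enveloping_incl_eq_iff:
  assumes "v \<in> carrier V" "w \<in> carrier V"
  shows "enveloping_incl U i p v = enveloping_incl U i p w \<longleftrightarrow> (\<exists>n. i n v = i n w)"
  using assms by (simp add: enveloping_incl_def limit_incl_eq_iff bracket_incl_closed
      bracket_incl_transition)

lemma inj_enveloping_incl_iff:
  "inj_on (enveloping_incl U i p) (carrier V) \<longleftrightarrow> (\<forall>n. inj_on (i n) (carrier V))"
  by (auto simp: inj_on_def enveloping_incl_eq_iff)

lemma inj_incl_iff_bracket_incl:
  "(\<forall>n. inj_on (i n) (carrier V)) \<longleftrightarrow> (\<forall>n. \<forall>v\<in>carrier V. b n (i n v) = v)"
proof (intro iffI allI ballI)
  fix n v assume inj: "\<forall>n. inj_on (i n) (carrier V)" and v: "v \<in> carrier V"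
  \<comment> \<open>Both sides equal \<open>p n (i n v)\<close>; thus injectivity is used at stage
    \<open>Suc n\<close>, not at \<open>n\<close>.\<close>
  have "i (Suc n) v = i (Suc n) (b n (i n v))"
    using bracket_proj[OF bracket_incl_primitive[OF v]] bracket_incl_Suc[OF v] by simp
  then show "b n (i n v) = v"
    using inj v bracket_closed[OF bracket_incl_primitive[OF v]] by (metis inj_onD)
qed (metis inj_on_inverseI)

text \<open>Forwards, the induced map sends \<open>x\<close> to \<open>i (Suc n) (b n x)\<close>,
  which \<open>b (Suc n)\<close> takes back to \<open>b n x\<close>. Backwards, induction on
  \<open>n\<close>, with compatibility applied to the primitive \<open>i n v\<close>.\<close>

lemma bracket_incl_iff_compatible:
  "(\<forall>n. \<forall>v\<in>carrier V. b n (i n v) = v) \<longleftrightarrow>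
    (\<forall>v\<in>carrier V. b 0 (i 0 v) = v) \<and>
    (\<forall>n. \<forall>x\<in>primitives K (U n). b (Suc n) (primitives_map K (U n) (p n) x) = b n x)"
  (is "?id \<longleftrightarrow> ?base \<and> ?step")
proof
  assume ?id
  then show "?base \<and> ?step"
    by (simp add: primitives_map_def bracket_proj bracket_closed)
next
  assume *: "?base \<and> ?step"
  have "b n (i n v) = v" if v: "v \<in> carrier V" for n v
  proof (induction n)
    case (Suc n)
    have "b (Suc n) (p n (i n v)) = b n (i n v)"
      using * bracket_incl_primitive[OF v] by (metis primitives_map_def restrict_apply')
    with Suc show ?case
      by (simp add: bracket_incl_Suc v)
  qed (use * v in simp)
  then show ?id by blast
qed

end

theorem proposition5p7:
  fixes K :: "('k, 'r) ring_scheme"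
    and V :: "('k, 'v, 'm) module_scheme"
    and c :: "('k, 'v) tensor \<Rightarrow> ('k, 'v) tensor"
    and U :: "nat \<Rightarrow> ('k, ('k, 'v) tensor) braided_bialg"
    and i :: "nat \<Rightarrow> 'v \<Rightarrow> ('k, 'v) tensor"
    and p :: "nat \<Rightarrow> ('k, 'v) tensor \<Rightarrow> ('k, 'v) tensor"
    and b :: "nat \<Rightarrow> ('k, 'v) tensor \<Rightarrow> 'v"
  assumes "field K"
    and "braided_vector_space K V c"
    and "bracket K V c U i p b"
  shows "(inj_on (enveloping_incl U i p) (carrier V) \<longleftrightarrow> braided_lie_algebra K V c U i p b) \<and>
    (inj_on (enveloping_incl U i p) (carrier V) \<longleftrightarrow> (\<forall>n. \<forall>v\<in>carrier V. b n (i n v) = v)) \<and>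
    (inj_on (enveloping_incl U i p) (carrier V) \<longleftrightarrow>
      (\<forall>v\<in>carrier V. b 0 (i 0 v) = v) \<and>
      (\<forall>n. \<forall>x\<in>primitives K (U n). b (Suc n) (primitives_map K (U n) (p n) x) = b n x))"
  \<comment> \<open>All three equivalences pass through injectivity of every \<open>i n\<close>,
    except the first, which only unfolds \<open>braided_lie_algebra\<close>.\<close>
  using assms
  by (simp add: braided_lie_algebra_def inj_enveloping_incl_iff inj_incl_iff_bracket_incl
      bracket_incl_iff_compatible)

end
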